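(* Let $Q^T\tau$ be a system of pairwise comparisons of $v$ treatments, let $w>0$ be a feasible design and let $G=(V,E)$ be the corresponding vertex-weighted graph. Then $$\Psi_{-\infty}(w)=\max_{\sum_i w_iy_i^2=1}\ \sum_{(i,j)\in E}(y_i-y_j)^2=\max_{\lVert y\rVert_w=1}\ \sum_{(i,j)\in E}(y_i-y_j)^2,$$ where $y\in\mathbb{R}^v$ and $\lVert y\rVert_w:=(\sum_iw_iy_i^2)^{1/2}$, and $$\Phi_{-\infty}(w)=\Big(\max_{\sum_iw_iy_i^2=1}\ \sum_{(i,j)\in E}(y_i-y_j)^2\Big)^{-1}.$$
   Context: A system of $s$ pairwise comparisons $Q^T\tau$ is given by a $v\times s$ matrix $Q$ every column of which represents a difference $\tau_j-\tau_i$ with $i\ne j$ (entry $1$ in row $j$, $-1$ in row $i$, zeros elsewhere), different columns corresponding to different unordered pairs $\{i,j\}$; no row of $Q$ is zero; $r=\mathrm{rank}(Q)$. The corresponding graph $G$ has vertex set $V=\{1,\ldots,v\}$, an edge $(j,i)$ for each comparison $\tau_j-\tau_i$ in the system, and vertex weights $\alpha_i=w_i^{-1}$. A design is $w$ with $w_i\in[0,1]$, $\sum_iw_i=1$; it is feasible if and only if $w_i>0$ for all $i$. $V_Q(w)=Q^T\mathrm{diag}(w)^{-1}Q$, $\Psi_{-\infty}(w)=\lambda_{\max}(V_Q(w))$, and $\Phi_{-\infty}(w)$ is the smallest positive eigenvalue $\lambda_r(C_Q(w))$ of $C_Q(w)=V_Q(w)^+$ (Moore-Penrose pseudoinverse;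 equal to $V_Q(w)^{-1}$ when $Q$ has full column rank), eigenvalues being ordered decreasingly. *)

theory Defs
  imports "HOL-Analysis.Analysis"
begin

text \<open>
  The \<open>v\<close> treatments are the elements of the finite type \<open>'v\<close>, the \<open>s\<close> comparisons (columns of
  \<open>Q\<close>) those of the finite type \<open>'s\<close>; a \<open>v \<times> s\<close> matrix therefore has type \<open>real^'s^'v\<close>.
\<close>

definition eigenvalue :: "real^'n^'n \<Rightarrow> real \<Rightarrow> bool" where
  "eigenvalue A l \<longleftrightarrow> (\<exists>x. x \<noteq> 0 \<and> A *v x = l *\<^sub>R x)"

text \<open>
  A matrix has only finitely many eigenvalues; both definitions are meaningful as soon as the set in
  question is nonempty. They are applied to symmetric positive semidefinite nonzero matrices only.
\<close>

definition max_eigenvalue :: "real^'n^'n \<Rightarrow> real" where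
  "max_eigenvalue A = Max {l. eigenvalue A l}"

definition min_pos_eigenvalue :: "real^'n^'n \<Rightarrow> real" where
  "min_pos_eigenvalue A = Min {l. eigenvalue A l \<and> 0 < l}"

definition is_pinv :: "real^'n^'m \<Rightarrow> real^'m^'n \<Rightarrow> bool" where
  "is_pinv A X \<longleftrightarrow>
     A ** X ** A = A \<and> X ** A ** X = X \<and>
     transpose (A ** X) = A ** X \<and> transpose (X ** A) = X ** A"

definition pinv :: "real^'n^'m \<Rightarrow> real^'m^'n" where
  "pinv A = (THE X. is_pinv A X)"

lemma is_pinv_unique:
  assumes X: "is_pinv A X" and Y: "is_pinv A Y"
  shows "X = Y"
proof -
  have "A ** X = (A ** Y) ** (A ** X)"
    using Y by (simp add: is_pinv_def matrix_mul_assoc)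
  also have "\<dots> = transpose ((A ** X) ** (A ** Y))"
    using X Y by (simp add: is_pinv_def matrix_transpose_mul)
  also have "\<dots> = A ** Y"
    using X Y by (simp add: is_pinv_def matrix_mul_assoc)
  finally have AX: "A ** X = A ** Y" .
  have "X ** A = (X ** A) ** (Y ** A)"
    using Y by (metis is_pinv_def matrix_mul_assoc)
  also have "\<dots> = transpose ((Y ** A) ** (X ** A))"
    using X Y by (simp add: is_pinv_def matrix_transpose_mul)
  also have "\<dots> = Y ** A"
    using X Y by (metis is_pinv_def matrix_mul_assoc)
  finally have XA: "X ** A = Y ** A" .
  have "X = X ** A ** X"
    using X by (simp add: is_pinv_def)
  also have "\<dots> = Y ** (A ** X)"
    by (simp add: XA matrix_mul_assoc)
  also have "\<dots> = Y"
    using Y by (simp add: AX is_pinv_def matrix_mul_assoc)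
  finally show ?thesis .
qed

text \<open>Column \<open>k\<close> of \<open>Q\<close> represents the comparison \<open>\<tau>\<^sub>j - \<tau>\<^sub>i\<close>.\<close>

definition represents_comparison :: "real^'s^'v \<Rightarrow> 's \<Rightarrow> 'v \<Rightarrow> 'v \<Rightarrow> bool" where
  "represents_comparison Q k j i \<longleftrightarrow> i \<noteq> j \<and> column k Q = axis j 1 - axis i 1"

definition pairwise_comparisons :: "real^'s^'v \<Rightarrow> bool" where
  "pairwise_comparisons Q \<longleftrightarrow>
     (\<forall>k. \<exists>j i. represents_comparison Q k j i) \<and>
     (\<forall>k k' j i j' i'. k \<noteq> k' \<longrightarrow> represents_comparison Q k j i \<longrightarrow>
        represents_comparison Q k' j' i' \<longrightarrow> {j, i} \<noteq> {j', i'}) \<and>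
     (\<forall>i. row i Q \<noteq> 0)"

text \<open>
  Edges are recorded with the orientation of their comparison, i.e. \<open>(j, i)\<close> stands for the
  undirected edge between \<open>j\<close> and \<open>i\<close>. In the graph of a system of pairwise comparisons every edge
  occurs with exactly one orientation, so summing a symmetric function of the end points over the
  edge set counts each edge once.
\<close>

record 'v vw_graph =
  verts :: "'v set"
  edges :: "('v \<times> 'v) set"
  vweight :: "'v \<Rightarrow> real"

definition comparison_graph :: "real^'s^'v \<Rightarrow> real^'v \<Rightarrow> 'v vw_graph" where
  "comparison_graph Q w =
     \<lparr>verts = UNIV,
      edges = {(j, i). \<exists>k. represents_comparison Q k j i},
      vweight = (\<lambda>i. inverse (w $ i))\<rparr>"

definition design :: "real^'v \<Rightarrow> bool" where
  "design w \<longleftrightarrow> (\<forall>i. 0 \<le> w $ i \<and> w $ i \<le> 1) \<and> (\<Sum>i\<in>UNIV. w $ i) = 1"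

definition feasible_design :: "real^'v \<Rightarrow> bool" where
  "feasible_design w \<longleftrightarrow> design w \<and> (\<forall>i. 0 < w $ i)"

definition diag_mat :: "real^'n \<Rightarrow> real^'n^'n" where
  "diag_mat w = (\<chi> i j. if i = j then w $ i else 0)"

definition V_mat :: "real^'s^'v \<Rightarrow> real^'v \<Rightarrow> real^'s^'s" where
  "V_mat Q w = transpose Q ** matrix_inv (diag_mat w) ** Q"

definition C_mat :: "real^'s^'v \<Rightarrow> real^'v \<Rightarrow> real^'s^'s" where
  "C_mat Q w = pinv (V_mat Q w)"

definition Psi_minf :: "real^'s^'v \<Rightarrow> real^'v \<Rightarrow> real" where
  "Psi_minf Q w = max_eigenvalue (V_mat Q w)"

definition Phi_minf :: "real^'s^'v \<Rightarrow> real^'v \<Rightarrow> real" where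
  "Phi_minf Q w = min_pos_eigenvalue (C_mat Q w)"

definition wnorm :: "real^'v \<Rightarrow> real^'v \<Rightarrow> real" where
  "wnorm w y = sqrt (\<Sum>i\<in>UNIV. w $ i * (y $ i)\<^sup>2)"

text \<open>
  \<open>is_max_on f S m\<close>: the maximum of \<open>f\<close> over \<open>S\<close> exists (is attained) and equals \<open>m\<close>. The operator
  \<^const>\<open>Max\<close> is not suitable here, since it is specified for finite sets only.
\<close>

definition is_max_on :: "('a \<Rightarrow> real) \<Rightarrow> 'a set \<Rightarrow> real \<Rightarrow> bool" where
  "is_max_on f S m \<longleftrightarrow> (\<exists>y\<in>S. f y = m) \<and> (\<forall>y\<in>S. f y \<le> m)"

end

theory Submission
  imports Defs
begin

text \<open>
  With \<open>W = diag(w)\<close>, the edge sum at \<open>y\<close> is \<open>|Q\<^sup>Ty|\<^sup>2\<close>. A maximiser \<open>y\<close> of this form on the compact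
  ellipsoid \<open>y\<^sup>TWy = 1\<close>, with maximum \<open>M\<close>, satisfies \<open>QQ\<^sup>Ty = MWy\<close>, because a positive semidefinite
  form vanishes only on the kernel of its matrix; hence \<open>Q\<^sup>Ty\<close> is an eigenvector of
  \<open>Q\<^sup>TW\<^sup>-\<^sup>1Q\<close> for \<open>M\<close>. Conversely, an eigenvector \<open>x\<close> for \<open>l\<close> yields \<open>y = W\<^sup>-\<^sup>1Qx\<close> with
  \<open>|Q\<^sup>Ty|\<^sup>2 = l\<^sup>2|x|\<^sup>2\<close> and \<open>y\<^sup>TWy = l|x|\<^sup>2\<close>, so that \<open>l \<le> M\<close>. The statement about the pseudoinverse
  follows because its positive eigenvalues are the reciprocals of those of the symmetric matrix
  itself.
\<close>

section \<open>Symmetric matrices\<close>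

lemma matrix_diff_ldistrib:
  fixes A :: "real^'n^'m"
  shows "A ** (B - C) = A ** B - A ** C"
  by (simp add: matrix_matrix_mult_def vec_eq_iff algebra_simps sum_subtractf)

lemma matrix_diff_rdistrib:
  fixes A :: "real^'n^'m"
  shows "(A - B) ** C = A ** C - B ** C"
  by (simp add: matrix_matrix_mult_def vec_eq_iff algebra_simps sum_subtractf)

lemma matrix_add_rdistrib:
  fixes A :: "real^'n^'m"
  shows "(A + B) ** C = A ** C + B ** C"
  by (simp add: matrix_matrix_mult_def vec_eq_iff algebra_simps sum.distrib)

lemma transpose_diff: "transpose (A - B :: real^'n^'m) = transpose A - transpose B"
  by (simp add: transpose_def vec_eq_iff)

lemma inner_matrix_vector_transpose:
  fixes A :: "real^'n^'m"
  shows "x \<bullet> (A *v y) = (transpose A *v x) \<bullet> y"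
  by (simp add: dot_lmul_matrix)

lemma symmetric_matrix_iff_inner:
  fixes A :: "real^'n^'n"
  shows "transpose A = A \<longleftrightarrow> (\<forall>x y. (A *v x) \<bullet> y = x \<bullet> (A *v y))"
proof
  assume "transpose A = A"
  then show "\<forall>x y. (A *v x) \<bullet> y = x \<bullet> (A *v y)"
    by (metis inner_matrix_vector_transpose)
next
  assume sym: "\<forall>x y. (A *v x) \<bullet> y = x \<bullet> (A *v y)"
  have "transpose A *v x = A *v x" for x
  proof (rule vector_eq_rdot[THEN iffD1], intro allI)
    fix z
    show "(transpose A *v x) \<bullet> z = (A *v x) \<bullet> z"
      using sym by (metis inner_matrix_vector_transpose)
  qed
  then show "transpose A = A"
    by (simp add: matrix_eq)
qed

section \<open>Existence and spectrum of the pseudoinverse of a symmetric matrix\<close>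

lemma orthogonal_projection_matrix:
  fixes S :: "(real^'n) set"
  assumes "subspace S"
  obtains P :: "real^'n^'n"
  where "transpose P = P" "\<And>x. P *v x \<in> S" "\<And>x. x \<in> S \<Longrightarrow> P *v x = x"
proof -
  obtain B where B: "B \<subseteq> S" "pairwise orthogonal B" "\<And>x. x \<in> B \<Longrightarrow> norm x = 1"
      "independent B" "span B = S"
    using orthonormal_basis_subspace[OF assms] by metis
  have fin: "finite B"
    using B(4) independent_imp_finite by blast
  define p where "p = (\<lambda>x. \<Sum>b\<in>B. (x \<bullet> b) *\<^sub>R b)"
  have lin: "linear p"
    unfolding p_def
    by (intro linearI)
      (auto simp: inner_add_left scaleR_add_left sum.distrib scaleR_sum_right)
  have P: "matrix p *v x = p x" for x
    using lin by (simp add: matrix_works)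
  have p_base: "p b = b" if "b \<in> B" for b
  proof -
    have "p b = (\<Sum>c\<in>B. if c = b then b else 0)"
      unfolding p_def
    proof (rule sum.cong[OF refl])
      fix c assume "c \<in> B"
      show "(b \<bullet> c) *\<^sub>R c = (if c = b then b else 0)"
      proof (cases "c = b")
        case True
        then show ?thesis using B(3)[OF that] by (simp add: dot_square_norm)
      next
        case False
        then have "b \<bullet> c = 0"
          using B(2) \<open>c \<in> B\<close> that by (auto simp: pairwise_def orthogonal_def)
        then show ?thesis using False by simp
      qed
    qed
    then show ?thesis using fin that by simp
  qed
  have "p x = x" if "x \<in> S" for x
    using linear_eq_on_span[OF lin linear_id, of B x] p_base B(5) that by simp
  moreover have "p x \<in> S" for x
    unfolding p_def using B(1) assms by (intro subspace_sum subspace_scale) auto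
  moreover have "p x \<bullet> y = x \<bullet> p y" for x y
    by (simp add: p_def inner_sum_left inner_sum_right inner_commute mult.commute)
  ultimately show thesis
    using that[of "matrix p"] by (simp add: P symmetric_matrix_iff_inner)
qed

text \<open>
  For \<open>P\<close> the orthogonal projection onto the kernel of \<open>A\<close>, the matrix \<open>A + P\<close> is invertible, and the
  pseudoinverse of \<open>A\<close> is \<open>(A + P)\<^sup>-\<^sup>1 - P\<close>.
\<close>

lemma symmetric_matrix_has_pinv:
  fixes A :: "real^'n^'n"
  assumes sym: "transpose A = A"
  obtains X where "is_pinv A X"
proof -
  have "subspace {x. A *v x = 0}"
    by (auto simp: subspace_def matrix_vector_right_distrib matrix_vector_mult_scaleR)
  then obtain P :: "real^'n^'n" where P: "transpose P = P" "\<And>x. A *v (P *v x) = 0"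
      "\<And>x. A *v x = 0 \<Longrightarrow> P *v x = x"
    using orthogonal_projection_matrix[of "{x. A *v x = 0}"] by auto
  have AP: "A ** P = 0"
    by (simp add: matrix_eq P(2) flip: matrix_vector_mul_assoc)
  have PA: "P ** A = 0"
    using arg_cong[OF AP, of transpose] by (simp add: matrix_transpose_mul sym P(1))
      (simp add: transpose_def vec_eq_iff)
  have PP: "P ** P = P"
    by (simp add: matrix_eq P(2,3) flip: matrix_vector_mul_assoc)
  define S where "S = A + P"
  \<comment> \<open>Applying \<open>P\<close> to \<open>S *v x = 0\<close> removes the
    \<open>A\<close> part and leaves \<open>P *v x = 0\<close>; then \<open>x\<close> lies in the
    kernel of \<open>A\<close>, where \<open>P\<close> is the identity.\<close>
  have "x = 0" if "S *v x = 0" for x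
  proof -
    have Sx: "A *v x + P *v x = 0"
      using that by (simp add: S_def matrix_vector_mult_add_rdistrib)
    have "P *v (A *v x + P *v x) = P *v x"
      by (simp add: matrix_vector_right_distrib matrix_vector_mul_assoc PA PP)
    then have "P *v x = 0" by (simp add: Sx)
    with Sx P(3)[of x] show ?thesis by simp
  qed
  then obtain T where TS: "T ** S = mat 1"
    using matrix_left_invertible_ker by blast
  then have ST: "S ** T = mat 1"
    using matrix_left_right_inverse by blast
  have SP: "S ** P = P" "P ** S = P"
    by (simp_all add: S_def matrix_add_ldistrib matrix_add_rdistrib AP PA PP)
  have TP: "T ** P = P"
    by (metis SP(1) TS matrix_mul_assoc matrix_mul_lid)
  have PT: "P ** T = P"
    by (metis SP(2) ST matrix_mul_assoc matrix_mul_rid)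
  have A: "A = S - P" by (simp add: S_def)
  \<comment> \<open>Both products turn out to be the projection onto the orthogonal complement of
    the kernel, from which all four Penrose conditions follow.\<close>
  have AX: "A ** (T - P) = mat 1 - P"
    by (simp add: A matrix_diff_ldistrib matrix_diff_rdistrib ST PT SP PP)
  have XA: "(T - P) ** A = mat 1 - P"
    by (simp add: A matrix_diff_ldistrib matrix_diff_rdistrib TS TP SP PP)
  have "is_pinv A (T - P)"
    unfolding is_pinv_def AX XA
    by (simp add: matrix_diff_ldistrib matrix_diff_rdistrib PA PP PT transpose_diff P(1))
  then show thesis by (rule that)
qed

lemma is_pinv_pinv:
  fixes A :: "real^'n^'n"
  assumes "transpose A = A"
  shows "is_pinv A (pinv A)"
proof -
  obtain X where "is_pinv A X"
    using symmetric_matrix_has_pinv[OF assms] .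
  then show ?thesis
    unfolding pinv_def using is_pinv_unique by (metis theI)
qed

lemma is_pinv_transpose:
  fixes A :: "real^'n^'m"
  assumes "is_pinv A X"
  shows "is_pinv (transpose A) (transpose X)"
proof -
  have X: "A ** X ** A = A" "X ** A ** X = X"
      "transpose (A ** X) = A ** X" "transpose (X ** A) = X ** A"
    using assms by (auto simp: is_pinv_def)
  have "transpose A ** transpose X ** transpose A = transpose A"
    by (metis X(1) matrix_transpose_mul matrix_mul_assoc)
  moreover have "transpose X ** transpose A ** transpose X = transpose X"
    by (metis X(2) matrix_transpose_mul matrix_mul_assoc)
  ultimately show ?thesis
    using X(3,4) by (simp add: is_pinv_def flip: matrix_transpose_mul)
qed

text \<open>Transposing the Penrose conditions and using uniqueness shows that \<open>pinv A\<close>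
  is symmetric; the symmetry of the product \<open>A ** pinv A\<close> then gives
  commutation.\<close>

lemma pinv_commute:
  fixes A :: "real^'n^'n"
  assumes sym: "transpose A = A"
  shows "A ** pinv A = pinv A ** A"
proof -
  let ?X = "pinv A"
  have X: "is_pinv A ?X" using sym by (rule is_pinv_pinv)
  then have "is_pinv A (transpose ?X)"
    using is_pinv_transpose sym by metis
  then have "transpose ?X = ?X"
    using X is_pinv_unique by blast
  then show ?thesis
    using X sym by (metis is_pinv_def matrix_transpose_mul)
qed

text \<open>Commutation rewrites the Penrose identities as \<open>X ** A ** A = A\<close> and
  \<open>A ** X ** X = X\<close>, so an eigenvector of either matrix for a nonzero eigenvalue is one
  of the other for the reciprocal.\<close>

lemma eigenvalue_pinv_iff:
  fixes A :: "real^'n^'n"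
  assumes sym: "transpose A = A" and "l \<noteq> 0"
  shows "eigenvalue (pinv A) l \<longleftrightarrow> eigenvalue A (inverse l)"
proof -
  let ?X = "pinv A"
  have X: "A ** ?X ** A = A" "?X ** A ** ?X = ?X"
    using is_pinv_pinv[OF sym] by (auto simp: is_pinv_def)
  have comm: "A ** ?X = ?X ** A" using sym by (rule pinv_commute)
  \<comment> \<open>Kept general in \<open>B\<close> and \<open>C\<close>, since the two directions
    differ only by exchanging \<open>A\<close> and \<open>pinv A\<close>.\<close>
  have *: "eigenvalue C (inverse m)"
    if e: "eigenvalue B m" and m: "m \<noteq> 0" and BC: "C ** B ** B = B" for B C :: "real^'n^'n" and m
  proof -
    obtain x where x: "x \<noteq> 0" "B *v x = m *\<^sub>R x"
      using e by (auto simp: eigenvalue_def)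
    have "m *\<^sub>R m *\<^sub>R (C *v x) = C *v (B *v (B *v x))"
      by (simp add: x(2) matrix_vector_mult_scaleR)
    also have "\<dots> = (C ** B ** B) *v x"
      by (simp add: matrix_vector_mul_assoc matrix_mul_assoc)
    also have "\<dots> = m *\<^sub>R x"
      by (simp add: BC x(2))
    finally have "m *\<^sub>R (C *v x) = x"
      using m scaleR_cancel_left by blast
    then have "C *v x = inverse m *\<^sub>R x"
      using m by (metis scaleR_one scaleR_scaleR left_inverse)
    then show ?thesis using x(1) by (auto simp: eigenvalue_def)
  qed
  have "?X ** A ** A = A" "A ** ?X ** ?X = ?X"
    using X by (simp_all add: comm)
  then show ?thesis
    using *[of ?X l A] *[of A "inverse l" ?X] assms(2) by auto
qed

text \<open>Eigenvectors for distinct eigenvalues are orthogonal, hence independent. Finiteness is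
  what lets \<open>Max\<close> and \<open>Min\<close> be evaluated.\<close>

lemma finite_eigenvalues_symmetric:
  fixes A :: "real^'n^'n"
  assumes sym: "transpose A = A"
  shows "finite {l. eigenvalue A l}"
proof -
  define f where "f l = (SOME x. x \<noteq> 0 \<and> A *v x = l *\<^sub>R x)" for l
  have f: "f l \<noteq> 0 \<and> A *v f l = l *\<^sub>R f l" if "eigenvalue A l" for l
    using that unfolding eigenvalue_def f_def by (rule someI_ex)
  have orth: "f l \<bullet> f m = 0" if "eigenvalue A l" "eigenvalue A m" "l \<noteq> m" for l m
  proof -
    have "(A *v f l) \<bullet> f m = f l \<bullet> (A *v f m)"
      using sym symmetric_matrix_iff_inner by blast
    then show ?thesis using f that by simp
  qed
  have inj: "inj_on f {l. eigenvalue A l}"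
    using f orth by (intro inj_onI) (metis inner_eq_zero_iff mem_Collect_eq)
  have "pairwise orthogonal (f ` {l. eigenvalue A l})"
    using orth by (auto simp: pairwise_def orthogonal_def)
  then have "independent (f ` {l. eigenvalue A l})"
    using f by (intro pairwise_orthogonal_independent) force+
  then show ?thesis
    using independent_imp_finite inj finite_imageD by blast
qed

text \<open>Moving from \<open>z\<close> by \<open>t\<close> times \<open>u = A *v z\<close> changes
  the form by \<open>2 * t * (u \<bullet> u)\<close> to first order; a small negative
  \<open>t\<close> would make it negative unless \<open>u = 0\<close>.\<close>

lemma psd_form_zero_imp_kernel:
  fixes A :: "real^'n^'n"
  assumes sym: "transpose A = A" and psd: "\<And>x. 0 \<le> x \<bullet> (A *v x)"
    and z: "z \<bullet> (A *v z) = 0"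
  shows "A *v z = 0"
proof -
  define u where "u = A *v z"
  define c where "c = u \<bullet> (A *v u)"
  have zu: "z \<bullet> (A *v u) = u \<bullet> u"
    using sym by (metis inner_matrix_vector_transpose u_def)
  have q: "0 \<le> t * (2 * (u \<bullet> u) + t * c)" for t
  proof -
    have "0 \<le> (z + t *\<^sub>R u) \<bullet> (A *v (z + t *\<^sub>R u))" by (rule psd)
    also have "\<dots> = t * (2 * (u \<bullet> u) + t * c)"
      using z zu
      by (simp add: matrix_vector_right_distrib matrix_vector_mult_scaleR inner_add_left
          inner_add_right c_def algebra_simps flip: u_def)
    finally show ?thesis .
  qed
  have "c \<ge> 0" unfolding c_def by (rule psd)
  \<comment> \<open>The \<open>+ 1\<close> covers \<open>c = 0\<close>; with this \<open>t\<close>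
    the factor \<open>2 * (u \<bullet> u) + t * c\<close> stays nonnegative while \<open>t\<close>
    is negative whenever \<open>u\<close> is nonzero.\<close>
  define t where "t = - (u \<bullet> u) / (c + 1)"
  have "2 * (u \<bullet> u) + t * c = (u \<bullet> u) * (c + 2) / (c + 1)"
    using \<open>c \<ge> 0\<close> by (simp add: t_def field_simps)
  then have "0 \<le> - ((u \<bullet> u)\<^sup>2 * ((c + 2) / (c + 1)\<^sup>2))"
    using q[of t] by (simp add: t_def power2_eq_square)
  moreover have "(c + 2) / (c + 1)\<^sup>2 > 0"
    using \<open>c \<ge> 0\<close> by simp
  ultimately have "(u \<bullet> u)\<^sup>2 \<le> 0"
    by (smt (verit) mult_pos_pos)
  then show ?thesis by (simp add: u_def)
qed

section \<open>Diagonal weights\<close>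

lemma diag_mat_mult_vec: "diag_mat w *v y = (\<chi> i. w $ i * y $ i)"
proof -
  have "(\<Sum>j\<in>UNIV. (if i = j then w $ i else 0) * y $ j) = w $ i * y $ i" for i
    by (simp add: if_distrib[of "\<lambda>a. a * _"] cong: if_cong)
  then show ?thesis
    by (simp add: diag_mat_def matrix_vector_mult_def vec_eq_iff)
qed

lemma transpose_diag_mat: "transpose (diag_mat w) = diag_mat w"
  by (simp add: diag_mat_def transpose_def vec_eq_iff)

lemma matrix_inv_diag_mat:
  assumes "\<And>i. w $ i \<noteq> 0"
  shows "matrix_inv (diag_mat w) = diag_mat (\<chi> i. inverse (w $ i))"
proof -
  let ?D = "diag_mat w" and ?E = "diag_mat (\<chi> i. inverse (w $ i))"
  have DE: "?D ** ?E = mat 1" and ED: "?E ** ?D = mat 1"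
    using assms by (simp_all add: matrix_eq diag_mat_mult_vec vec_eq_iff
        flip: matrix_vector_mul_assoc)
  \<comment> \<open>\<open>matrix_inv\<close> is a choice among two-sided inverses; the witness
    \<open>?E\<close> makes the choice meaningful.\<close>
  then have "?D ** matrix_inv ?D = mat 1"
    unfolding matrix_inv_def by (metis (mono_tags, lifting) someI)
  then show ?thesis
    by (metis ED matrix_mul_assoc matrix_mul_lid matrix_mul_rid)
qed

text \<open>Each summand is at most 1, so positive weights bound every coordinate by
  \<open>sqrt (inverse (w $ i))\<close>.\<close>

lemma compact_weighted_sphere:
  fixes w :: "real^'n"
  assumes "\<And>i. 0 < w $ i"
  shows "compact {y :: real^'n. (\<Sum>i\<in>UNIV. w $ i * (y $ i)\<^sup>2) = 1}" (is "compact ?S")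
proof -
  have "norm y \<le> (\<Sum>i\<in>UNIV. sqrt (inverse (w $ i)))" if "y \<in> ?S" for y
  proof -
    have "\<bar>y $ i\<bar> \<le> sqrt (inverse (w $ i))" for i
    proof (rule real_le_rsqrt)
      have "w $ i * (y $ i)\<^sup>2 \<le> (\<Sum>i\<in>UNIV. w $ i * (y $ i)\<^sup>2)"
        by (rule member_le_sum) (simp_all add: assms less_imp_le)
      then show "\<bar>y $ i\<bar>\<^sup>2 \<le> inverse (w $ i)"
        using that assms[of i] by (simp add: field_simps)
    qed
    then have "(\<Sum>i\<in>UNIV. \<bar>y $ i\<bar>) \<le> (\<Sum>i\<in>UNIV. sqrt (inverse (w $ i)))"
      by (intro sum_mono)
    then show ?thesis using norm_le_l1_cart[of y] by linarith
  qed
  then have "bounded ?S" by (auto simp: bounded_iff)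
  moreover have "closed ?S"
    by (intro closed_Collect_eq continuous_intros)
  ultimately show ?thesis by (simp add: compact_eq_bounded_closed)
qed

section \<open>Pairwise comparisons\<close>

lemma represents_comparison_transpose_mult:
  assumes "represents_comparison Q k j i"
  shows "(transpose Q *v y) $ k = y $ j - y $ i"
proof -
  have "(transpose Q *v y) $ k = column k Q \<bullet> y"
    by (simp add: matrix_vector_mult_def transpose_def column_def inner_vec_def)
  also have "\<dots> = y $ j - y $ i"
    using assms by (simp add: represents_comparison_def inner_diff_left inner_axis')
  finally show ?thesis .
qed

lemma represents_comparison_unique:
  assumes "represents_comparison Q k j i" "represents_comparison Q k j' i'"
  shows "j = j' \<and> i = i'"
proof -
  have "i \<noteq> j"
    using assms(1) by (simp add: represents_comparison_def)
  have "y $ j - y $ i = y $ j' - y $ i'" for y :: "real^_"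
    using represents_comparison_transpose_mult[OF assms(1), of y]
      represents_comparison_transpose_mult[OF assms(2), of y] by simp
  \<comment> \<open>The first test vector forces \<open>j' = j\<close>, the second
    \<open>i' = i\<close>.\<close>
  from this[of "axis j 1"] this[of "axis i 1"] have
    "(if j' = j then 1 else 0) - (if i' = j then 1 else 0) = (1 :: real)"
    "(if j' = i then 1 else 0) - (if i' = i then 1 else 0) = (- 1 :: real)"
    using \<open>i \<noteq> j\<close>
    by (simp_all only: axis_def vec_lambda_beta if_False if_True not_sym refl) simp_all
  then show ?thesis by (simp split: if_splits)
qed

text \<open>Columns correspond bijectively to oriented edges: injectively because unordered pairs do
  not repeat, surjectively because a column determines its orientation. Coordinate \<open>k\<close>
  of \<open>transpose Q *v y\<close> is the difference along edge \<open>k\<close>.\<close>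

lemma edge_sum_eq:
  assumes "pairwise_comparisons Q"
  shows "(\<Sum>(i, j)\<in>edges (comparison_graph Q w). (y $ i - y $ j)\<^sup>2)
    = (transpose Q *v y) \<bullet> (transpose Q *v y)"
proof -
  obtain f g where fg: "\<And>k. represents_comparison Q k (f k) (g k)"
    using assms unfolding pairwise_comparisons_def by metis
  define h where "h k = (f k, g k)" for k
  have "inj h"
  proof (rule injI, rule ccontr)
    fix k k' assume "h k = h k'" "k \<noteq> k'"
    then have "represents_comparison Q k' (f k) (g k)"
      using fg[of k'] by (simp add: h_def)
    then show False
      using assms fg[of k] \<open>k \<noteq> k'\<close> unfolding pairwise_comparisons_def by blast
  qed
  have "edges (comparison_graph Q w) = range h"
  proof (rule set_eqI)
    fix e
    show "e \<in> edges (comparison_graph Q w) \<longleftrightarrow> e \<in> range h"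
      using fg represents_comparison_unique[OF fg]
      by (cases e) (fastforce simp: comparison_graph_def h_def image_iff)
  qed
  then have "(\<Sum>(i, j)\<in>edges (comparison_graph Q w). (y $ i - y $ j)\<^sup>2)
      = (\<Sum>k\<in>UNIV. (y $ f k - y $ g k)\<^sup>2)"
    using \<open>inj h\<close> by (simp add: sum.reindex) (simp add: h_def)
  also have "\<dots> = (transpose Q *v y) \<bullet> (transpose Q *v y)"
    by (simp only: inner_vec_def represents_comparison_transpose_mult[OF fg] power2_eq_square
        inner_real_def)
  finally show ?thesis .
qed

lemma pairwise_comparisons_nonzero:
  fixes Q :: "real^'s^'v"
  assumes "pairwise_comparisons Q"
  obtains y where "transpose Q *v y \<noteq> 0"
proof -
  \<comment> \<open>Types are nonempty, so some comparison exists.\<close>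
  fix k :: 's
  obtain j i where r: "represents_comparison Q k j i"
    using assms unfolding pairwise_comparisons_def by metis
  then have "(transpose Q *v axis j 1) $ k = 1"
    by (simp only: represents_comparison_transpose_mult)
      (auto simp: axis_def represents_comparison_def)
  then show thesis
    using that[of "axis j 1"] by force
qed

section \<open>Eigenvalues of \<open>V_mat Q w\<close> and the weighted variational problem\<close>

lemma transpose_V_mat:
  assumes "\<And>i. 0 < w $ i"
  shows "transpose (V_mat Q w) = V_mat Q w"
proof -
  have "w $ i \<noteq> 0" for i using assms[of i] by simp
  then show ?thesis
    by (simp add: V_mat_def matrix_inv_diag_mat matrix_transpose_mul transpose_diag_mat
        matrix_mul_assoc)
qed

lemma V_mat_mult_vec:
  assumes "\<And>i. 0 < w $ i"
  shows "V_mat Q w *v x = transpose Q *v (\<chi> i. inverse (w $ i) * (Q *v x) $ i)"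
proof -
  have "w $ i \<noteq> 0" for i using assms[of i] by simp
  then show ?thesis
    by (simp add: V_mat_def matrix_inv_diag_mat diag_mat_mult_vec flip: matrix_vector_mul_assoc)
qed

lemma inner_diag_mat: "y \<bullet> (diag_mat w *v y) = (\<Sum>i\<in>UNIV. w $ i * (y $ i)\<^sup>2)"
  by (simp add: diag_mat_mult_vec inner_vec_def power2_eq_square mult_ac)

lemma eigenvalue_V_mat_le:
  fixes Q :: "real^'s^'v"
  assumes w: "\<And>i. 0 < w $ i" and M: "0 \<le> M"
    and bound: "\<And>y. (transpose Q *v y) \<bullet> (transpose Q *v y) \<le> M * (y \<bullet> (diag_mat w *v y))"
    and l: "eigenvalue (V_mat Q w) l"
  shows "l \<le> M"
proof -
  obtain x where x: "x \<noteq> 0" "V_mat Q w *v x = l *\<^sub>R x"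
    using l by (auto simp: eigenvalue_def)
  define y where "y = (\<chi> i. inverse (w $ i) * (Q *v x) $ i)"
  have Qy: "transpose Q *v y = l *\<^sub>R x"
    using x(2) V_mat_mult_vec[OF w, of Q x] by (simp add: y_def del: transpose_matrix_vector)
  have "w $ i \<noteq> 0" for i using w[of i] by simp
  then have Wy: "diag_mat w *v y = Q *v x"
    by (simp add: y_def diag_mat_mult_vec vec_eq_iff)
  have "y \<bullet> (diag_mat w *v y) = l * (x \<bullet> x)"
    unfolding Wy by (simp add: inner_matrix_vector_transpose Qy del: transpose_matrix_vector)
  with bound[of y] have "l * l * (x \<bullet> x) \<le> M * l * (x \<bullet> x)"
    by (simp add: Qy mult.assoc del: transpose_matrix_vector)
  then have "l * l \<le> M * l"
    using x(1) by (meson inner_gt_zero_iff mult_right_le_imp_le)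
  \<comment> \<open>A positive \<open>l\<close> cancels; otherwise
    \<open>l \<le> 0 \<le> M\<close>.\<close>
  then show ?thesis
    using M by (cases "l > 0") auto
qed

lemma eigenvalue_V_mat_maximizer:
  fixes Q :: "real^'s^'v"
  assumes w: "\<And>i. 0 < w $ i" and M: "0 < M"
    and bound: "\<And>y. (transpose Q *v y) \<bullet> (transpose Q *v y) \<le> M * (y \<bullet> (diag_mat w *v y))"
    and z: "(transpose Q *v z) \<bullet> (transpose Q *v z) = M" "z \<bullet> (diag_mat w *v z) = 1"
  shows "eigenvalue (V_mat Q w) M"
proof -
  \<comment> \<open>The form of \<open>A\<close> is the slack in \<open>bound\<close>: nonnegative
    everywhere and zero at \<open>z\<close>.\<close>
  define A where "A = M *\<^sub>R diag_mat w - Q ** transpose Q"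
  have A: "A *v y = M *\<^sub>R (diag_mat w *v y) - Q *v (transpose Q *v y)" for y
    by (simp add: A_def matrix_vector_mult_diff_rdistrib scaleR_matrix_vector_assoc
        flip: matrix_vector_mul_assoc)
  have form: "y \<bullet> (A *v y) = M * (y \<bullet> (diag_mat w *v y)) - (transpose Q *v y) \<bullet> (transpose Q *v y)"
    for y
    by (simp add: A inner_diff_right inner_matrix_vector_transpose[of _ Q]
        del: transpose_matrix_vector)
  have "transpose (M *\<^sub>R diag_mat w) = M *\<^sub>R diag_mat w"
    by (simp add: diag_mat_def transpose_def vec_eq_iff)
  then have "transpose A = A"
    by (simp add: A_def transpose_diff matrix_transpose_mul)
  then have "A *v z = 0"
    using bound z by (intro psd_form_zero_imp_kernel) (simp_all add: form)
  then have "Q *v (transpose Q *v z) = M *\<^sub>R (diag_mat w *v z)"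
    by (simp add: A)
  moreover have "w $ i \<noteq> 0" for i using w[of i] by simp
  ultimately have "(\<chi> i. inverse (w $ i) * (Q *v (transpose Q *v z)) $ i) = M *\<^sub>R z"
    by (simp add: diag_mat_mult_vec vec_eq_iff del: transpose_matrix_vector)
  then have "V_mat Q w *v (transpose Q *v z) = M *\<^sub>R (transpose Q *v z)"
    by (simp only: V_mat_mult_vec[OF w] matrix_vector_mult_scaleR)
  moreover have "transpose Q *v z \<noteq> 0"
    using z(1) M by force
  ultimately show ?thesis unfolding eigenvalue_def by blast
qed

theorem corollary2:
  fixes Q :: "real^'s^'v" and w :: "real^'v" and G :: "'v vw_graph"
  assumes "pairwise_comparisons Q"
    and "feasible_design w"
    and "G = comparison_graph Q w"
  shows "\<exists>M.
    is_max_on (\<lambda>y :: real^'v. \<Sum>(i, j)\<in>edges G. (y $ i - y $ j)\<^sup>2)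
      {y. (\<Sum>i\<in>UNIV. w $ i * (y $ i)\<^sup>2) = 1} M \<and>
    is_max_on (\<lambda>y :: real^'v. \<Sum>(i, j)\<in>edges G. (y $ i - y $ j)\<^sup>2)
      {y. wnorm w y = 1} M \<and>
    Psi_minf Q w = M \<and>
    Phi_minf Q w = inverse M"
proof -
  have w: "0 < w $ i" for i
    using assms(2) by (simp add: feasible_design_def)
  have w_sum: "(\<Sum>i\<in>UNIV. w $ i) = 1"
    using assms(2) by (simp add: feasible_design_def design_def)
  define q where "q y = (transpose Q *v y) \<bullet> (transpose Q *v y)" for y
  define n where "n y = (\<Sum>i\<in>UNIV. w $ i * (y $ i)\<^sup>2)" for y
  define S where "S = {y. n y = 1}"
  have edge_sum: "(\<lambda>y. \<Sum>(i, j)\<in>edges G. (y $ i - y $ j)\<^sup>2) = q"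
    unfolding assms(3) q_def edge_sum_eq[OF assms(1)] ..
  have sphere: "{y. (\<Sum>i\<in>UNIV. w $ i * (y $ i)\<^sup>2) = 1} = S" "{y. wnorm w y = 1} = S"
    by (simp_all add: S_def n_def wnorm_def)
  \<comment> \<open>The all-ones vector has weighted norm 1 because the weights of a design sum to
    1.\<close>
  have "vec 1 \<in> S" using w_sum by (simp add: S_def n_def)
  moreover have "compact S"
    unfolding S_def n_def using w by (rule compact_weighted_sphere)
  moreover have "continuous_on S q"
    unfolding q_def by (intro continuous_intros matrix_vector_mult_linear_continuous_on)
  ultimately obtain z where z: "z \<in> S" "\<And>y. y \<in> S \<Longrightarrow> q y \<le> q z"
    using continuous_attains_sup[of S q] by blast
  define M where "M = q z"
  have max: "is_max_on q S M"
    using z unfolding is_max_on_def M_def by blast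
  \<comment> \<open>\<open>q\<close> and \<open>n\<close> are both homogeneous of degree 2, so the
    bound on \<open>S\<close> extends to all vectors by rescaling with \<open>c\<close>.\<close>
  have bound: "q y \<le> M * n y" for y
  proof (cases "y = 0")
    case True
    then show ?thesis by (simp add: q_def n_def)
  next
    case False
    then obtain i where "y $ i \<noteq> 0" by (auto simp: vec_eq_iff)
    then have "0 < w $ i * (y $ i)\<^sup>2" using w by simp
    then have pos: "0 < n y"
      unfolding n_def using w by (intro sum_pos2[of _ i]) (simp_all add: less_imp_le)
    define c where "c = inverse (sqrt (n y))"
    have c2: "c\<^sup>2 * n y = 1" "c\<^sup>2 > 0" using pos by (simp_all add: c_def power_inverse)
    have "n (c *\<^sub>R y) = c\<^sup>2 * n y"
      by (simp add: n_def sum_distrib_left power_mult_distrib mult_ac)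
    then have "c *\<^sub>R y \<in> S" using c2 by (simp add: S_def)
    moreover have "q (c *\<^sub>R y) = c\<^sup>2 * q y"
      unfolding q_def matrix_vector_mult_scaleR by (simp add: power2_eq_square)
    ultimately have "c\<^sup>2 * q y \<le> M * (c\<^sup>2 * n y)"
      using z(2) c2 by (fastforce simp: M_def)
    then have "c\<^sup>2 * q y \<le> c\<^sup>2 * (M * n y)" by (simp add: mult_ac)
    then show ?thesis using c2(2) by simp
  qed
  \<comment> \<open>A single vector with \<open>q u > 0\<close> forces \<open>M > 0\<close>, so that
    \<open>M\<close> counts among the positive eigenvalues.\<close>
  obtain u where "transpose Q *v u \<noteq> 0"
    using pairwise_comparisons_nonzero[OF assms(1)] .
  then have "0 < q u" unfolding q_def by (simp only: inner_gt_zero_iff) simp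
  then have "0 < M * n u" using bound[of u] by linarith
  moreover have "0 \<le> n u" using w by (simp add: n_def sum_nonneg less_imp_le)
  ultimately have M: "0 < M" by (simp add: zero_less_mult_iff)
  let ?V = "V_mat Q w"
  have le: "l \<le> M" if "eigenvalue ?V l" for l
    using eigenvalue_V_mat_le[of w M Q l] w M bound that
    unfolding q_def n_def inner_diag_mat by (meson less_imp_le)
  have eigM: "eigenvalue ?V M"
    using eigenvalue_V_mat_maximizer[of w M Q z] w M bound z(1)
    unfolding q_def n_def inner_diag_mat S_def M_def by blast
  have sym: "transpose ?V = ?V" using w by (rule transpose_V_mat)
  have fin: "finite {l. eigenvalue ?V l}"
    using sym by (rule finite_eigenvalues_symmetric)
  have Psi: "Psi_minf Q w = M"
    unfolding Psi_minf_def max_eigenvalue_def using fin le eigM by (intro Max_eqI) auto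
  \<comment> \<open>Inversion reverses the order of positive reals, so the largest eigenvalue
    \<open>M\<close> of \<open>?V\<close> yields the smallest positive one of
    \<open>C_mat Q w\<close>.\<close>
  have C: "{l. eigenvalue (C_mat Q w) l \<and> 0 < l} = inverse ` {l. eigenvalue ?V l \<and> 0 < l}"
  proof (intro set_eqI iffI)
    fix l assume "l \<in> {l. eigenvalue (C_mat Q w) l \<and> 0 < l}"
    then show "l \<in> inverse ` {l. eigenvalue ?V l \<and> 0 < l}"
      using eigenvalue_pinv_iff[OF sym, of l]
      by (intro image_eqI[of _ _ "inverse l"]) (auto simp: C_mat_def)
  next
    fix l assume "l \<in> inverse ` {l. eigenvalue ?V l \<and> 0 < l}"
    then show "l \<in> {l. eigenvalue (C_mat Q w) l \<and> 0 < l}"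
      using eigenvalue_pinv_iff[OF sym] by (auto simp: C_mat_def)
  qed
  have "Phi_minf Q w = inverse M"
    unfolding Phi_minf_def min_pos_eigenvalue_def C
  proof (rule Min_eqI)
    show "finite (inverse ` {l. eigenvalue ?V l \<and> 0 < l})"
      using fin by simp
    show "inverse M \<in> inverse ` {l. eigenvalue ?V l \<and> 0 < l}"
      using eigM M by blast
    show "inverse M \<le> l" if "l \<in> inverse ` {l. eigenvalue ?V l \<and> 0 < l}" for l
      using that le by (auto intro: le_imp_inverse_le)
  qed
  with max Psi show ?thesis
    unfolding edge_sum sphere by blast
qed

end
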